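(* Let $G=(V_P\cup V_L,E)$ be a point-hyperplane graph, let $\hat p:V_P\to\mathbb{A}^d$ and $\ell=(a,r):V_L\to\mathbb{S}^{d-1}\times\mathbb{R}$, so that $(G,\hat p,\ell)$ is a point-hyperplane framework in $\mathbb{A}^d$. Let $q:V_P\cup V_L\to\mathbb{S}^d_{\ge 0}$ be defined by $q_i=\hat p_i/\|\hat p_i\|$ for $i\in V_P$ (central projection) and $q_i=(a_i,0)\in\mathbb{R}^d\times\mathbb{R}$ for $i\in V_L$ (a point on the equator of $\mathbb{S}^d$). Then $(G,\hat p,\ell)$ is infinitesimally rigid if and only if the spherical bar-joint framework $(G,q)$ is infinitesimally rigid.
   Context: Write points of $\mathbb{R}^{d+1}$ as $(x,x')\in\mathbb{R}^d\times\mathbb{R}$; let $\mathbf e=(0,\dots,0,1)\in\mathbb{R}^{d+1}$, $\mathbb{A}^d=\{x\in\mathbb{R}^{d+1}:\langle x,\mathbf e\rangle=1\}$, $\mathbb{S}^d$ the unit sphere in $\mathbb{R}^{d+1}$ and $\mathbb{S}^d_{\ge0}=\{x\in\mathbb{S}^d:\langle x,\mathbf e\rangle\ge 0\}$. A point-hyperplane graph is a graph $G$ whose vertex set is partitioned into $V_P$ (points) and $V_L$ (hyperplanes); its edge set $E$ splits as $E_{PP},E_{PL},E_{LL}$ according to the types of the endpoints. In a point-hyperplane framework $(G,\hat p,\ell)$ in $\mathbb{A}^d$ we regard $\ell_j=(a_j,r_j)\in\mathbb{R}^{d+1}$. An infinitesimal motion of $(G,\hat p,\ell)$ is a pair $(\dot{\hat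 p},\dot\ell)$ with $\dot{\hat p}_i\in\mathbb{R}^{d+1}$ ($i\in V_P$) and $\dot\ell_j=(\dot a_j,\dot r_j)\in\mathbb{R}^d\times\mathbb{R}$ ($j\in V_L$) satisfying: $\langle \hat p_i-\hat p_j,\dot{\hat p}_i-\dot{\hat p}_j\rangle=0$ for $ij\in E$ with $i,j\in V_P$; $\langle\hat p_i,\dot\ell_j\rangle+\langle\dot{\hat p}_i,\ell_j\rangle=0$ for $ij\in E$ with $i\in V_P,j\in V_L$; $\langle a_i,\dot a_j\rangle+\langle\dot a_i,a_j\rangle=0$ for $ij\in E$ with $i,j\in V_L$; $\langle\dot{\hat p}_i,\mathbf e\rangle=0$ for $i\in V_P$; $\langle a_i,\dot a_i\rangle=0$ for $i\in V_L$. The framework is infinitesimally rigid if its space of infinitesimal motions has dimension $\binom{d+1}{2}$ (the paper assumes the points and hyperplanes affinely span). A spherical bar-joint framework $(G,q)$ with $q:V\to\mathbb{S}^d$ has infinitesimal motions $\dot q:V\to\mathbb{R}^{d+1}$ satisfying $\langle q_i,\dot q_j\rangle+\langle q_j,\dot q_i\rangle=0$ for $ij\in E$ and $\langle q_i,\dot q_i\rangle=0$ for $i\in V$; it is infinitesimally rigid if this space has dimension $\binom{d+1}{2}$ (the paper assumes $q(V)$ linearly spans $\mathbb{R}^{d+1}$). *)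

theory Defs
  imports "HOL-Analysis.Analysis"
begin

text \<open>Here \<open>d = CARD('d)\<close>, and \<open>\<real>\<^sup>d\<^sup>+\<^sup>1\<close> is the Euclidean product space \<open>\<real>\<^sup>d \<times> \<real>\<close>.\<close>

type_synonym 'd rspace = "(real ^ 'd) \<times> real"

definition evec :: "('d::finite) rspace" where
  "evec = (0, 1)"

definition affine_slice :: "('d::finite) rspace set" where
  "affine_slice = {x. x \<bullet> evec = 1}"

definition upper_hemisphere :: "('d::finite) rspace set" where
  "upper_hemisphere = {x \<in> sphere 0 1. x \<bullet> evec \<ge> 0}"

text \<open>The vertex set is \<open>VP \<union> VL\<close>, an arbitrary subset of a finite ambient type; edges are
  two-element sets of vertices.\<close>

definition point_hyperplane_graph :: "'v set \<Rightarrow> 'v set \<Rightarrow> 'v set set \<Rightarrow> bool" where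
  "point_hyperplane_graph VP VL E \<longleftrightarrow>
     VP \<inter> VL = {} \<and> (\<forall>e\<in>E. e \<subseteq> VP \<union> VL \<and> card e = 2)"

text \<open>The hyperplane \<open>\<ell>\<^sub>j = (a\<^sub>j, r\<^sub>j)\<close> has unit normal \<open>a\<^sub>j = fst (l j)\<close>. Values of \<open>p\<close>
  off \<open>VP\<close> and of \<open>l\<close> off \<open>VL\<close> are irrelevant.\<close>

definition point_hyperplane_framework ::
  "'v set \<Rightarrow> 'v set \<Rightarrow> 'v set set \<Rightarrow> ('v \<Rightarrow> ('d::finite) rspace) \<Rightarrow> ('v \<Rightarrow> 'd rspace) \<Rightarrow> bool" where
  "point_hyperplane_framework VP VL E p l \<longleftrightarrow>
     point_hyperplane_graph VP VL E \<and>
     (\<forall>i\<in>VP. p i \<in> affine_slice) \<and> (\<forall>j\<in>VL. l j \<in> sphere 0 1 \<times> UNIV)"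

text \<open>A family indexed by a subset of the vertices is represented by a vector indexed by the whole
  ambient type that vanishes off that subset, so that \<open>dim\<close> below is the dimension of the space of
  families.\<close>

definition ph_motions ::
  "'v set \<Rightarrow> 'v set \<Rightarrow> 'v set set \<Rightarrow> ('v \<Rightarrow> ('d::finite) rspace) \<Rightarrow> ('v \<Rightarrow> 'd rspace)
     \<Rightarrow> (('d rspace ^ 'v::finite) \<times> ('d rspace ^ 'v)) set" where
  "ph_motions VP VL E p l = {(p', l').
     (\<forall>i. i \<notin> VP \<longrightarrow> p' $ i = 0) \<and> (\<forall>j. j \<notin> VL \<longrightarrow> l' $ j = 0) \<and>
     (\<forall>i\<in>VP. \<forall>j\<in>VP. {i, j} \<in> E \<longrightarrow> (p i - p j) \<bullet> (p' $ i - p' $ j) = 0) \<and>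
     (\<forall>i\<in>VP. \<forall>j\<in>VL. {i, j} \<in> E \<longrightarrow> p i \<bullet> l' $ j + p' $ i \<bullet> l j = 0) \<and>
     (\<forall>i\<in>VL. \<forall>j\<in>VL. {i, j} \<in> E \<longrightarrow>
        fst (l i) \<bullet> fst (l' $ j) + fst (l' $ i) \<bullet> fst (l j) = 0) \<and>
     (\<forall>i\<in>VP. p' $ i \<bullet> evec = 0) \<and>
     (\<forall>i\<in>VL. fst (l i) \<bullet> fst (l' $ i) = 0)}"

text \<open>Rigidity is the dimension criterion. The usual convention that the framework spans, under
  which the isometries contribute exactly this dimension, is not imposed.\<close>

definition ph_infinitesimally_rigid ::
  "'v::finite set \<Rightarrow> 'v set \<Rightarrow> 'v set set \<Rightarrow> ('v \<Rightarrow> ('d::finite) rspace) \<Rightarrow> ('v \<Rightarrow> 'd rspace) \<Rightarrow> bool"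
  where
  "ph_infinitesimally_rigid VP VL E p l \<longleftrightarrow>
     dim (ph_motions VP VL E p l) = (CARD('d) + 1) choose 2"

definition spherical_motions ::
  "'v set \<Rightarrow> 'v set set \<Rightarrow> ('v \<Rightarrow> ('d::finite) rspace) \<Rightarrow> ('d rspace ^ 'v::finite) set" where
  "spherical_motions V E q = {q'.
     (\<forall>i. i \<notin> V \<longrightarrow> q' $ i = 0) \<and>
     (\<forall>i\<in>V. \<forall>j\<in>V. {i, j} \<in> E \<longrightarrow> q i \<bullet> q' $ j + q j \<bullet> q' $ i = 0) \<and>
     (\<forall>i\<in>V. q i \<bullet> q' $ i = 0)}"

definition spherical_infinitesimally_rigid ::
  "'v::finite set \<Rightarrow> 'v set set \<Rightarrow> ('v \<Rightarrow> ('d::finite) rspace) \<Rightarrow> bool" where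
  "spherical_infinitesimally_rigid V E q \<longleftrightarrow>
     dim (spherical_motions V E q) = (CARD('d) + 1) choose 2"

lemma add_eq_0_pairwise:
  "u + v = 0 \<Longrightarrow> u' + v' = 0 \<Longrightarrow> (u + u') + (v + v') = 0" for u u' v v' :: real
  by simp

lemma subspace_ph_motions: "subspace (ph_motions VP VL E p l)"
proof (rule subspaceI)
  show "0 \<in> ph_motions VP VL E p l"
    by (simp add: ph_motions_def case_prod_beta)
next
  fix x y assume "x \<in> ph_motions VP VL E p l" "y \<in> ph_motions VP VL E p l"
  then show "x + y \<in> ph_motions VP VL E p l"
    unfolding ph_motions_def case_prod_beta mem_Collect_eq
    by (intro conjI allI ballI impI)
      (simp_all add: inner_add_left inner_add_right add_diff_add add_eq_0_pairwise)
next
  fix c x assume "x \<in> ph_motions VP VL E p l"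
  then show "c *\<^sub>R x \<in> ph_motions VP VL E p l"
    by (cases x) (simp add: ph_motions_def flip: distrib_left scaleR_diff_right)
qed

lemma subspace_spherical_motions: "subspace (spherical_motions V E q)"
proof (rule subspaceI)
  show "0 \<in> spherical_motions V E q"
    by (simp add: spherical_motions_def)
next
  fix x y assume "x \<in> spherical_motions V E q" "y \<in> spherical_motions V E q"
  then show "x + y \<in> spherical_motions V E q"
    unfolding spherical_motions_def mem_Collect_eq
    by (intro conjI allI ballI impI) (simp_all add: inner_add_right add_eq_0_pairwise)
next
  fix c x assume "x \<in> spherical_motions V E q"
  then show "c *\<^sub>R x \<in> spherical_motions V E q"
    by (simp add: spherical_motions_def flip: distrib_left)
qed

definition spherical_projection ::
  "'v set \<Rightarrow> ('v \<Rightarrow> ('d::finite) rspace) \<Rightarrow> ('v \<Rightarrow> 'd rspace) \<Rightarrow> 'v \<Rightarrow> 'd rspace" where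
  "spherical_projection VP p l i = (if i \<in> VP then p i /\<^sub>R norm (p i) else (fst (l i), 0))"

lemma spherical_projection_in_upper_hemisphere:
  assumes "point_hyperplane_framework VP VL E p l" "i \<in> VP \<union> VL"
  shows "spherical_projection VP p l i \<in> upper_hemisphere"
proof -
  have "norm (p i) \<noteq> 0" if "i \<in> VP"
    using assms that by (auto simp: point_hyperplane_framework_def affine_slice_def)
  with assms show ?thesis
    by (auto simp: point_hyperplane_framework_def spherical_projection_def upper_hemisphere_def
        affine_slice_def evec_def norm_Pair)
qed

end

theory Submission
  imports Defs
begin

text \<open>A motion of the point \<open>p\<^sub>i\<close> in the affine slice is horizontal. The corresponding velocity of
  \<open>p\<^sub>i / \<parallel>p\<^sub>i\<parallel>\<close> is \<open>1 / \<parallel>p\<^sub>i\<parallel>\<close> times the unique vector with the same horizontal part that is orthogonal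
  to \<open>p\<^sub>i\<close>, and the velocity \<open>(a', r')\<close> of a hyperplane is taken as it stands for the velocity of the
  equatorial point \<open>(a, 0)\<close>. Up to nonzero factors this turns the constraints of the two frameworks
  into each other, so the two spaces of motions are isomorphic.\<close>

definition to_spherical ::
  "'v set \<Rightarrow> ('v \<Rightarrow> ('d::finite) rspace) \<Rightarrow> ('d rspace ^ 'v::finite) \<times> ('d rspace ^ 'v) \<Rightarrow> 'd rspace ^ 'v"
  where
  "to_spherical VP p m = (\<chi> i. if i \<in> VP
     then (fst (fst m $ i), - (p i \<bullet> fst m $ i)) /\<^sub>R norm (p i) else snd m $ i)"

definition from_spherical ::
  "'v set \<Rightarrow> ('v \<Rightarrow> ('d::finite) rspace) \<Rightarrow> 'd rspace ^ 'v::finite \<Rightarrow> ('d rspace ^ 'v) \<times> ('d rspace ^ 'v)"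
  where
  "from_spherical VP p q' =
     (\<chi> i. if i \<in> VP then (norm (p i) *\<^sub>R fst (q' $ i), 0) else 0, \<chi> i. if i \<in> VP then 0 else q' $ i)"

lemma inner_evec: "x \<bullet> evec = snd x"
  by (simp add: evec_def inner_prod_def)

lemma affine_slice_snd: "x \<in> affine_slice \<longleftrightarrow> snd x = 1"
  by (simp add: affine_slice_def inner_evec)

lemma linear_to_spherical: "linear (to_spherical VP p)"
  by (rule linearI)
    (simp_all add: to_spherical_def vec_eq_iff prod_eq_iff inner_add_right algebra_simps)

lemma to_spherical_in_motions:
  assumes "point_hyperplane_framework VP VL E p l" and "m \<in> ph_motions VP VL E p l"
  shows "to_spherical VP p m \<in> spherical_motions (VP \<union> VL) E (spherical_projection VP p l)"
proof -
  obtain p' l' where m: "m = (p', l')"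
    by (cases m)
  let ?q = "spherical_projection VP p l" and ?q' = "to_spherical VP p m"
  have disj: "VP \<inter> VL = {}" and slice: "\<And>i. i \<in> VP \<Longrightarrow> snd (p i) = 1"
    using assms(1)
    by (auto simp: point_hyperplane_framework_def point_hyperplane_graph_def affine_slice_snd)
  have off: "\<And>j. j \<notin> VL \<Longrightarrow> l' $ j = 0"
    and PP: "\<And>i j. i \<in> VP \<Longrightarrow> j \<in> VP \<Longrightarrow> {i, j} \<in> E \<Longrightarrow> (p i - p j) \<bullet> (p' $ i - p' $ j) = 0"
    and PL: "\<And>i j. i \<in> VP \<Longrightarrow> j \<in> VL \<Longrightarrow> {i, j} \<in> E \<Longrightarrow> p i \<bullet> l' $ j + p' $ i \<bullet> l j = 0"
    and LL: "\<And>i j. i \<in> VL \<Longrightarrow> j \<in> VL \<Longrightarrow> {i, j} \<in> E \<Longrightarrow>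
        fst (l i) \<bullet> fst (l' $ j) + fst (l' $ i) \<bullet> fst (l j) = 0"
    and P: "\<And>i. i \<in> VP \<Longrightarrow> snd (p' $ i) = 0"
    and L: "\<And>i. i \<in> VL \<Longrightarrow> fst (l i) \<bullet> fst (l' $ i) = 0"
    using assms(2) by (auto simp: m ph_motions_def inner_evec)
  have qP: "?q i = p i /\<^sub>R norm (p i)"
    and q'P: "?q' $ i = (fst (p' $ i), - (p i \<bullet> p' $ i)) /\<^sub>R norm (p i)" if "i \<in> VP" for i
    using that by (simp_all add: spherical_projection_def to_spherical_def m)
  have qL: "?q i = (fst (l i), 0)" and q'L: "?q' $ i = l' $ i" if "i \<in> VL" for i
    using that disj by (auto simp: spherical_projection_def to_spherical_def m)
  have PP': "?q i \<bullet> ?q' $ j + ?q j \<bullet> ?q' $ i = 0" if "i \<in> VP" "j \<in> VP" "{i, j} \<in> E" for i j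
  proof -
    \<comment> \<open>Since both points have height 1, the last coordinates contribute exactly the
      diagonal terms \<open>- (p j \<bullet> p' $ j)\<close> and
      \<open>- (p i \<bullet> p' $ i)\<close>, which complete the mixed terms to the product of
      differences.\<close>
    have "?q i \<bullet> ?q' $ j + ?q j \<bullet> ?q' $ i
        = - ((p i - p j) \<bullet> (p' $ i - p' $ j)) / (norm (p i) * norm (p j))"
      using that by (simp add: qP q'P inner_prod_def slice P field_simps inner_diff_left inner_diff_right
          add_divide_distrib diff_divide_distrib)
    with PP[OF that] show ?thesis by simp
  qed
  have PL': "?q i \<bullet> ?q' $ j + ?q j \<bullet> ?q' $ i = 0" if "i \<in> VP" "j \<in> VL" "{i, j} \<in> E" for i j
  proof -
    \<comment> \<open>The equatorial point has height 0, so it does not see the last coordinate of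
      \<open>?q' $ i\<close>; dually, \<open>p' $ i\<close> is horizontal, so it does not see the
      offset in \<open>l j\<close>.\<close>
    have "?q i \<bullet> ?q' $ j + ?q j \<bullet> ?q' $ i = (p i \<bullet> l' $ j + p' $ i \<bullet> l j) / norm (p i)"
      using that by (simp add: qP q'P qL q'L inner_prod_def slice P field_simps inner_commute
          add_divide_distrib)
    with PL[OF that] show ?thesis by simp
  qed
  have LL': "?q i \<bullet> ?q' $ j + ?q j \<bullet> ?q' $ i = 0" if "i \<in> VL" "j \<in> VL" "{i, j} \<in> E" for i j
    using LL[OF that] that by (simp add: qL q'L inner_prod_def inner_commute)
  have "?q i \<bullet> ?q' $ j + ?q j \<bullet> ?q' $ i = 0"
    if "i \<in> VP \<union> VL" "j \<in> VP \<union> VL" "{i, j} \<in> E" for i j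
    \<comment> \<open>Edges are unordered, so a mixed edge may also be listed with its hyperplane
      first.\<close>
    using that PP' PL' LL' PL'[of j i] by (auto simp: insert_commute add.commute)
  moreover have "?q i \<bullet> ?q' $ i = 0" if "i \<in> VP \<union> VL" for i
  proof (cases "i \<in> VP")
    case True
    then show ?thesis
      by (simp add: qP q'P inner_prod_def slice P)
  next
    case False
    with that L show ?thesis
      by (simp add: qL q'L inner_prod_def)
  qed
  moreover have "?q' $ i = 0" if "i \<notin> VP \<union> VL" for i
    using that off by (simp add: to_spherical_def m)
  ultimately show ?thesis
    by (simp add: spherical_motions_def)
qed

lemma from_spherical_in_motions:
  assumes "point_hyperplane_framework VP VL E p l"
    and q': "q' \<in> spherical_motions (VP \<union> VL) E (spherical_projection VP p l)"
  shows "from_spherical VP p q' \<in> ph_motions VP VL E p l"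
    and "to_spherical VP p (from_spherical VP p q') = q'"
proof -
  let ?q = "spherical_projection VP p l"
  have disj: "VP \<inter> VL = {}" and slice: "\<And>i. i \<in> VP \<Longrightarrow> snd (p i) = 1"
    and nz: "\<And>i. i \<in> VP \<Longrightarrow> p i \<noteq> 0"
    using assms(1)
    by (auto simp: point_hyperplane_framework_def point_hyperplane_graph_def affine_slice_snd)
  have off: "\<And>i. i \<notin> VP \<Longrightarrow> i \<notin> VL \<Longrightarrow> q' $ i = 0"
    and orth: "\<And>i. i \<in> VP \<union> VL \<Longrightarrow> ?q i \<bullet> q' $ i = 0"
    and edge: "\<And>i j. i \<in> VP \<union> VL \<Longrightarrow> j \<in> VP \<union> VL \<Longrightarrow> {i, j} \<in> E \<Longrightarrow>
        ?q i \<bullet> q' $ j + ?q j \<bullet> q' $ i = 0"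
    using q' unfolding spherical_motions_def by blast+
  have qP: "?q i = p i /\<^sub>R norm (p i)" if "i \<in> VP" for i
    using that by (simp add: spherical_projection_def)
  have qL: "?q i = (fst (l i), 0)" and notP: "i \<notin> VP" if "i \<in> VL" for i
    using that disj by (auto simp: spherical_projection_def)
  \<comment> \<open>Because \<open>p i\<close> has height 1, orthogonality to it can be solved for
    the last coordinate. This is what makes \<open>from_spherical\<close> lossless on spherical
    motions.\<close>
  have snd_q': "snd (q' $ i) = - (fst (p i) \<bullet> fst (q' $ i))" if "i \<in> VP" for i
    using orth[of i] that nz[OF that]
    by (simp add: qP inner_prod_def slice flip: distrib_left)
  have PP: "(p i - p j) \<bullet> ((norm (p i) *\<^sub>R fst (q' $ i), 0::real) - (norm (p j) *\<^sub>R fst (q' $ j), 0)) = 0"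
    if "i \<in> VP" "j \<in> VP" "{i, j} \<in> E" for i j
  proof -
    \<comment> \<open>Both norms appear because each of the two spherical terms pairs a point
      normalized by one norm with a velocity rescaled by the other.\<close>
    have "(p i - p j) \<bullet> ((norm (p i) *\<^sub>R fst (q' $ i), 0::real) - (norm (p j) *\<^sub>R fst (q' $ j), 0))
        = - (norm (p i) * norm (p j)) * (?q i \<bullet> q' $ j + ?q j \<bullet> q' $ i)"
      using that nz[OF that(1)] nz[OF that(2)]
      by (simp add: qP inner_prod_def slice snd_q' field_simps inner_diff_left inner_diff_right)
    with edge[of i j] that show ?thesis by simp
  qed
  have PL: "p i \<bullet> q' $ j + (norm (p i) *\<^sub>R fst (q' $ i), 0) \<bullet> l j = 0"
    if "i \<in> VP" "j \<in> VL" "{i, j} \<in> E" for i j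
  proof -
    have "p i \<bullet> q' $ j + (norm (p i) *\<^sub>R fst (q' $ i), 0) \<bullet> l j
        = norm (p i) * (?q i \<bullet> q' $ j + ?q j \<bullet> q' $ i)"
      using that nz[OF that(1)]
      by (simp add: qP qL inner_prod_def field_simps inner_commute)
    with edge[of i j] that show ?thesis by simp
  qed
  have LL: "fst (l i) \<bullet> fst (q' $ j) + fst (q' $ i) \<bullet> fst (l j) = 0"
    if "i \<in> VL" "j \<in> VL" "{i, j} \<in> E" for i j
    using edge[of i j] that by (simp add: qL inner_prod_def inner_commute)
  have L: "fst (l i) \<bullet> fst (q' $ i) = 0" if "i \<in> VL" for i
    using orth[of i] that by (simp add: qL inner_prod_def)
  show "from_spherical VP p q' \<in> ph_motions VP VL E p l"
    unfolding from_spherical_def ph_motions_def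
    using PP PL LL L off by (simp add: notP inner_evec)
  show "to_spherical VP p (from_spherical VP p q') = q'"
    using nz
    by (auto simp: to_spherical_def from_spherical_def vec_eq_iff prod_eq_iff inner_prod_def snd_q')
qed

text \<open>The heights of \<open>p'\<close> are recovered as 0 because it is horizontal.
  Disjointness of \<open>VP\<close> and \<open>VL\<close> makes \<open>l'\<close> vanish on
  \<open>VP\<close>, where \<open>to_spherical\<close> forgets it.\<close>

lemma from_to_spherical:
  assumes "point_hyperplane_framework VP VL E p l" and "m \<in> ph_motions VP VL E p l"
  shows "from_spherical VP p (to_spherical VP p m) = m"
proof -
  have "VP \<inter> VL = {}" and "\<And>i. i \<in> VP \<Longrightarrow> p i \<noteq> 0"
    using assms(1)
    by (auto simp: point_hyperplane_framework_def point_hyperplane_graph_def affine_slice_snd)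
  with assms(2) show ?thesis
    by (auto simp: ph_motions_def inner_evec to_spherical_def from_spherical_def vec_eq_iff prod_eq_iff)
qed

theorem theorem2p2:
  fixes VP VL :: "'v::finite set" and E :: "'v set set"
    and p l :: "'v \<Rightarrow> (real ^ 'd::finite) \<times> real"
  assumes "point_hyperplane_framework VP VL E p l"
  shows "ph_infinitesimally_rigid VP VL E p l \<longleftrightarrow>
         spherical_infinitesimally_rigid (VP \<union> VL) E (spherical_projection VP p l)"
proof -
  let ?M = "ph_motions VP VL E p l"
    and ?S = "spherical_motions (VP \<union> VL) E (spherical_projection VP p l)"
  have "inj_on (to_spherical VP p) ?M"
    by (metis inj_onI from_to_spherical[OF assms])
  \<comment> \<open>\<open>dim_image_eq\<close> asks for injectivity on the span. It fails on the
    whole space, where \<open>p'\<close> off \<open>VP\<close> and \<open>l'\<close> on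
    \<open>VP\<close> are lost, but the motions already form a subspace.\<close>
  then have "inj_on (to_spherical VP p) (span ?M)"
    by (simp add: span_eq_iff[THEN iffD2] subspace_ph_motions)
  moreover have "to_spherical VP p ` ?M = ?S"
    using to_spherical_in_motions[OF assms] from_spherical_in_motions[OF assms]
    by (auto intro!: image_eqI[OF sym])
  ultimately have "dim ?M = dim ?S"
    using dim_image_eq[OF linear_to_spherical] by metis
  then show ?thesis
    by (simp add: ph_infinitesimally_rigid_def spherical_infinitesimally_rigid_def)
qed

end
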